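(* Let $G$ be a finite group that contains a normal subgroup $A$ such that $C_G(A) \le A$ and $[A,x]$ is contained in the center of $A$ for every small element $x$ of $G$. Then $M(G)$ is nilpotent of class at most $3$.
   Context: For a finite group $G$, an element $x \in G$ is called small if $x$ is non-central and its conjugacy class has the smallest size among all conjugacy classes of non-central elements of $G$. $M(G)$ denotes the subgroup of $G$ generated by all small elements of $G$ (trivial if there are none). $C_G(A)$ is the centralizer of $A$ in $G$. Commutators are $[x,h] = x^{-1}h^{-1}xh$. For $x \in G$ and a subgroup $A \le G$, $[A,x]$ denotes the set $\{[a,x] : a \in A\}$. *)

theory Defs
  imports "HOL-Algebra.Algebra"
begin

definition commutator :: "('a, 'b) monoid_scheme \<Rightarrow> 'a \<Rightarrow> 'a \<Rightarrow> 'a" where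
  "commutator G x h = inv\<^bsub>G\<^esub> x \<otimes>\<^bsub>G\<^esub> inv\<^bsub>G\<^esub> h \<otimes>\<^bsub>G\<^esub> x \<otimes>\<^bsub>G\<^esub> h"

definition centralizer :: "('a, 'b) monoid_scheme \<Rightarrow> 'a set \<Rightarrow> 'a set" where
  "centralizer G A = {g \<in> carrier G. \<forall>a\<in>A. g \<otimes>\<^bsub>G\<^esub> a = a \<otimes>\<^bsub>G\<^esub> g}"

(* The center of a subgroup A of G is group_center (G\<lparr>carrier := A\<rparr>). *)
definition group_center :: "('a, 'b) monoid_scheme \<Rightarrow> 'a set" where
  "group_center G = centralizer G (carrier G)"

(* The action is the one of group.action_by_conjugation. *)
definition conj_class :: "('a, 'b) monoid_scheme \<Rightarrow> 'a \<Rightarrow> 'a set" where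
  "conj_class G x =
     orbit G (\<lambda>g. \<lambda>h \<in> carrier G. g \<otimes>\<^bsub>G\<^esub> h \<otimes>\<^bsub>G\<^esub> inv\<^bsub>G\<^esub> g) x"

(* Class sizes are measured by card, so this is meant for finite G only. *)
definition small_element :: "('a, 'b) monoid_scheme \<Rightarrow> 'a \<Rightarrow> bool" where
  "small_element G x \<longleftrightarrow>
     x \<in> carrier G - group_center G \<and>
     (\<forall>y \<in> carrier G - group_center G. card (conj_class G x) \<le> card (conj_class G y))"

definition small_subgroup :: "('a, 'b) monoid_scheme \<Rightarrow> 'a set" where
  "small_subgroup G = generate G {x. small_element G x}"

(* Indexed from 0: lower_central G n is the (n+1)-st term gamma_(n+1) of the
   lower central series gamma_1 = G, gamma_(i+1) = [gamma_i, G]. *)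
primrec lower_central :: "('a, 'b) monoid_scheme \<Rightarrow> nat \<Rightarrow> 'a set" where
  "lower_central G 0 = carrier G"
| "lower_central G (Suc n) =
     generate G {commutator G x h | x h. x \<in> lower_central G n \<and> h \<in> carrier G}"

definition nilpotent_group :: "('a, 'b) monoid_scheme \<Rightarrow> bool" where
  "nilpotent_group G \<longleftrightarrow> group G \<and> (\<exists>n. lower_central G n = {\<one>\<^bsub>G\<^esub>})"

(* Only meaningful for nilpotent groups; the trivial group has class 0. *)
definition nilpotency_class :: "('a, 'b) monoid_scheme \<Rightarrow> nat" where
  "nilpotency_class G = (LEAST n. lower_central G n = {\<one>\<^bsub>G\<^esub>})"

end

theory Submission
  imports Defs
begin

text \<open>
  The heart of the matter is a counting argument in the manner of Mann: if \<open>x\<close> is small,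
  then all commutators \<open>[a,x]\<close> with \<open>a \<in> A\<close> are central in \<open>G\<close>. Put \<open>C = C\<^sub>G(x)\<close> and
  \<open>S = {[a,x] | a \<in> A}\<close>. The set \<open>S\<close> has \<open>\<bar>A : A \<inter> C\<bar>\<close> elements and is permuted by \<open>C\<close>, so an element
  \<open>y \<noteq> 1\<close> of \<open>S\<close> has fewer than \<open>\<bar>A : A \<inter> C\<bar>\<close> conjugates under \<open>C\<close>. As \<open>S\<close> lies in the center of \<open>A\<close>,
  the group \<open>A\<close> does not move \<open>y\<close>, whereas it moves \<open>x\<close> to \<open>\<bar>A : A \<inter> C\<bar>\<close> places. Hence \<open>y\<close> has fewer
  conjugates in \<open>G\<close> than \<open>x\<close>, and by minimality it is central (lemma \<open>small_commutator_central\<close>).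

  The elements that centralize \<open>A\<close> modulo the center \<open>Z\<close> of \<open>G\<close> form a subgroup (lemma
  \<open>subgroup_centralizing_mod_center\<close>). It contains all small elements and therefore \<open>M = M(G)\<close>; that
  is, \<open>[A,M] \<le> Z\<close>. Conjugation by an element of \<open>M\<close> multiplies each element of \<open>A\<close> by a central
  factor, so the actions of any two elements of \<open>M\<close> on \<open>A\<close> commute, and \<open>[M,M] \<le> C\<^sub>G(A) \<le> A\<close> (lemma
  \<open>commutator_centralizes\<close>). Consequently \<open>[M,M,M] \<le> [A,M] \<le> Z\<close> and
  \<open>[M,M,M,M] = 1\<close>.
\<close>

section \<open>Counting conjugates\<close>

context group
begin

lemma centralizer_subgroup:
  assumes "B \<subseteq> carrier G"
  shows "subgroup (centralizer G B) G"
proof (rule subgroupI)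
  show "centralizer G B \<subseteq> carrier G" by (auto simp: centralizer_def)
  show "centralizer G B \<noteq> {}"
    using assms one_closed by (force simp: centralizer_def)
next
  fix g assume g: "g \<in> centralizer G B"
  have "inv g \<otimes> a = a \<otimes> inv g" if "a \<in> B" for a
  proof -
    have "g \<otimes> a = a \<otimes> g" "a \<in> carrier G" "g \<in> carrier G"
      using g that assms by (auto simp: centralizer_def)
    thus ?thesis by (metis inv_closed inv_solve_left' inv_solve_right m_assoc m_closed)
  qed
  thus "inv g \<in> centralizer G B" using g by (auto simp: centralizer_def)
next
  fix g h assume "g \<in> centralizer G B" "h \<in> centralizer G B"
  then show "g \<otimes> h \<in> centralizer G B"
    using assms unfolding centralizer_def by (auto simp: subset_iff) (metis m_assoc)
qed

text \<open>All the counting below rests on this: it yields Lagrange's theorem, the orbit formula and the size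
  of a set of commutators. Right cosets of \<open>K\<close> occur as fibres because elements are conjugated from
  the right.\<close>

lemma card_eq_card_image_mult_card_subgroup:
  assumes H: "subgroup H G" "finite H" and K: "subgroup K G" "K \<subseteq> H"
    and fibre: "\<And>g h. g \<in> H \<Longrightarrow> h \<in> H \<Longrightarrow> f g = f h \<longleftrightarrow> g \<otimes> inv h \<in> K"
  shows "card H = card (f ` H) * card K"
proof -
  have "card {g \<in> H. f g = b} = card K" if b: "b \<in> f ` H" for b
  proof -
    obtain h where h: "h \<in> H" "b = f h" using b by auto
    have hG: "h \<in> carrier G" and HG: "H \<subseteq> carrier G" and KG: "K \<subseteq> carrier G"
      using h H(1) K(1) subgroup.subset by blast+
    have "{g \<in> H. f g = b} = (\<lambda>k. k \<otimes> h) ` K"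
    proof (intro equalityI subsetI)
      fix g assume "g \<in> {g \<in> H. f g = b}"
      hence g: "g \<in> H" "g \<otimes> inv h \<in> K" using fibre h by auto
      have "g = (g \<otimes> inv h) \<otimes> h" using g(1) HG hG by (simp add: m_assoc subset_iff)
      thus "g \<in> (\<lambda>k. k \<otimes> h) ` K" using g(2) by blast
    next
      fix g assume "g \<in> (\<lambda>k. k \<otimes> h) ` K"
      then obtain k where k: "k \<in> K" "g = k \<otimes> h" by auto
      have "g \<in> H" using k K(2) h(1) subgroup.m_closed[OF H(1)] by auto
      moreover have "g \<otimes> inv h = k" using k KG hG by (simp add: m_assoc subset_iff)
      ultimately show "g \<in> {g \<in> H. f g = b}" using fibre[of g h] h k by auto
    qed
    moreover have "inj_on (\<lambda>k. k \<otimes> h) K"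
      using hG KG by (intro inj_onI) (simp add: subset_iff)
    ultimately show ?thesis by (simp add: card_image)
  qed
  moreover have "card H = (\<Sum>b\<in>f ` H. card {g \<in> H. f g = b})"
    using sum.image_gen[OF H(2), of "\<lambda>_. 1::nat" f] by simp
  ultimately show ?thesis by simp
qed

lemma conj_eq_iff_centralizer:
  assumes "x \<in> carrier G" "g \<in> carrier G" "h \<in> carrier G"
  shows "inv g \<otimes> x \<otimes> g = inv h \<otimes> x \<otimes> h \<longleftrightarrow> g \<otimes> inv h \<in> centralizer G {x}"
proof -
  have "inv g \<otimes> x \<otimes> g = inv h \<otimes> x \<otimes> h \<longleftrightarrow> x \<otimes> g = g \<otimes> (inv h \<otimes> x \<otimes> h)"
    using assms by (simp add: m_assoc inv_solve_left')
  also have "\<dots> \<longleftrightarrow> x \<otimes> g \<otimes> inv h = g \<otimes> inv h \<otimes> x"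
    using assms by (simp add: inv_solve_right' flip: m_assoc)
  finally show ?thesis using assms by (auto simp: centralizer_def m_assoc)
qed

lemma conj_class_eq:
  assumes "x \<in> carrier G"
  shows "conj_class G x = (\<lambda>g. inv g \<otimes> x \<otimes> g) ` carrier G"
proof -
  have "conj_class G x = (\<lambda>g. g \<otimes> x \<otimes> inv g) ` carrier G"
    using assms by (auto simp: conj_class_def orbit_def)
  also have "\<dots> = (\<lambda>g. inv g \<otimes> x \<otimes> g) ` carrier G"
  proof (intro equalityI subsetI)
    fix z assume "z \<in> (\<lambda>g. g \<otimes> x \<otimes> inv g) ` carrier G"
    then obtain g where "g \<in> carrier G" "z = g \<otimes> x \<otimes> inv g" by auto
    thus "z \<in> (\<lambda>g. inv g \<otimes> x \<otimes> g) ` carrier G"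
      by (intro image_eqI[of _ _ "inv g"]) auto
  next
    fix z assume "z \<in> (\<lambda>g. inv g \<otimes> x \<otimes> g) ` carrier G"
    then obtain g where "g \<in> carrier G" "z = inv g \<otimes> x \<otimes> g" by auto
    thus "z \<in> (\<lambda>g. g \<otimes> x \<otimes> inv g) ` carrier G"
      by (intro image_eqI[of _ _ "inv g"]) auto
  qed
  finally show ?thesis .
qed

lemma card_conj_class_mult_card_centralizer:
  assumes "finite (carrier G)" "x \<in> carrier G"
  shows "card (conj_class G x) * card (centralizer G {x}) = order G"
  unfolding order_def conj_class_eq[OF assms(2)]
  by (rule card_eq_card_image_mult_card_subgroup[symmetric, OF subgroup_self assms(1)
        centralizer_subgroup])
    (use assms conj_eq_iff_centralizer in \<open>auto simp: centralizer_def\<close>)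

text \<open>Large centralizers force elements into the center, since class size and centralizer order are
  inversely proportional.\<close>

lemma small_element_centralizer:
  assumes "finite (carrier G)" "small_element G x" "y \<in> carrier G"
    and "card (centralizer G {x}) < card (centralizer G {y})"
  shows "y \<in> group_center G"
proof (rule ccontr)
  assume "y \<notin> group_center G"
  hence le: "card (conj_class G x) \<le> card (conj_class G y)" and x: "x \<in> carrier G"
    using assms(2,3) by (auto simp: small_element_def)
  have "card (conj_class G y) > 0"
    using card_conj_class_mult_card_centralizer[OF assms(1,3)] order_gt_0_iff_finite assms(1)
    by (metis gr_zeroI mult_0 less_irrefl)
  with le assms(4) have "card (conj_class G x) * card (centralizer G {x})
      < card (conj_class G y) * card (centralizer G {y})"
    by (meson le_less_trans mult_le_mono1 mult_less_mono2)
  thus False using card_conj_class_mult_card_centralizer[OF assms(1)] assms(3) x by simp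
qed

lemma commutator_eq_iff_centralizer:
  assumes "x \<in> carrier G" "g \<in> carrier G" "h \<in> carrier G"
  shows "commutator G g x = commutator G h x \<longleftrightarrow> g \<otimes> inv h \<in> centralizer G {x}"
proof -
  have "commutator G g x = commutator G h x \<longleftrightarrow> inv g \<otimes> inv x \<otimes> g = inv h \<otimes> inv x \<otimes> h"
    using assms by (simp add: commutator_def)
  also have "\<dots> \<longleftrightarrow> g \<otimes> inv h \<in> centralizer G {inv x}"
    using assms by (simp add: conj_eq_iff_centralizer)
  also have "\<dots> \<longleftrightarrow> g \<otimes> inv h \<in> centralizer G {x}"
  proof -
    have "u \<otimes> inv x = inv x \<otimes> u \<longleftrightarrow> u \<otimes> x = x \<otimes> u" if u: "u \<in> carrier G" for u
    proof -
      have "u \<otimes> inv x = inv x \<otimes> u \<longleftrightarrow> u = inv x \<otimes> u \<otimes> x"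
        using u assms(1) by (metis inv_closed inv_solve_right m_closed)
      also have "\<dots> \<longleftrightarrow> x \<otimes> u = u \<otimes> x"
        using u assms(1) by (simp add: m_assoc inv_solve_left) metis
      finally show ?thesis by metis
    qed
    then show ?thesis using assms by (simp add: centralizer_def)
  qed
  finally show ?thesis .
qed

lemma conj_mult:
  assumes "c \<in> carrier G" "u \<in> carrier G" "v \<in> carrier G"
  shows "inv c \<otimes> (u \<otimes> v) \<otimes> c = (inv c \<otimes> u \<otimes> c) \<otimes> (inv c \<otimes> v \<otimes> c)"
proof -
  have "c \<otimes> (inv c \<otimes> (v \<otimes> c)) = v \<otimes> c"
    using assms by (simp add: m_assoc[symmetric])
  thus ?thesis using assms by (simp add: m_assoc)
qed

lemma conj_commutator:
  assumes c: "c \<in> centralizer G {x}" and "x \<in> carrier G" "a \<in> carrier G"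
  shows "inv c \<otimes> commutator G a x \<otimes> c = commutator G (inv c \<otimes> a \<otimes> c) x"
proof -
  have cG: "c \<in> carrier G" and cx: "c \<otimes> x = x \<otimes> c" using c by (auto simp: centralizer_def)
  have x: "inv c \<otimes> x \<otimes> c = x"
    using cG cx assms(2) by (simp add: m_assoc inv_solve_left')
  have inv: "inv c \<otimes> inv u \<otimes> c = inv (inv c \<otimes> u \<otimes> c)" if "u \<in> carrier G" for u
    using cG that by (simp add: inv_mult_group m_assoc)
  show ?thesis
    using cG assms(2,3) unfolding commutator_def by (simp only: conj_mult inv x inv_closed m_closed)
qed

text \<open>With \<open>C\<close>, \<open>Y\<close> the centralizers of \<open>x\<close>, \<open>y\<close> and \<open>D = C \<inter> Y\<close>, \<open>B = A \<inter> C\<close>: as \<open>A \<le> Y\<close>, the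
  group \<open>Y\<close> contains each of the \<open>\<bar>D : B\<bar>\<close> cosets of \<open>A\<close> that meet \<open>D\<close>, so its order is at least
  \<open>\<bar>D\<bar> \<cdot> \<bar>A : B\<bar>\<close>. The order of \<open>C\<close> is \<open>\<bar>D\<bar>\<close> times the number of \<open>C\<close>-conjugates of \<open>y\<close>, and these lie
  among the \<open>\<bar>A : B\<bar>\<close> commutators \<open>[a,x]\<close> without exhausting them, since \<open>1\<close> is another one. So
  \<open>\<bar>C\<bar> < \<bar>Y\<bar>\<close>. Normality of \<open>A\<close> is what lets \<open>C\<close> permute the commutators.\<close>

lemma small_commutator_central:
  assumes fin: "finite (carrier G)" and A: "A \<lhd> G" and x: "small_element G x"
    and comm: "\<And>a. a \<in> A \<Longrightarrow> commutator G a x \<in> centralizer G A"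
    and a: "a \<in> A"
  shows "commutator G a x \<in> group_center G"
proof (cases "commutator G a x = \<one>")
  case True
  then show ?thesis by (simp add: group_center_def centralizer_def)
next
  case False
  define y where "y = commutator G a x"
  define C where "C = centralizer G {x}"
  define Y where "Y = centralizer G {y}"
  define D where "D = C \<inter> Y"
  define B where "B = A \<inter> C"
  define S where "S = (\<lambda>a. commutator G a x) ` A"
  define T where "T = (\<lambda>c. inv c \<otimes> y \<otimes> c) ` C"
  define r where "r = (\<lambda>g. A #> g)"
  have subA: "subgroup A G" using A by (rule normal_imp_subgroup)
  have AG: "A \<subseteq> carrier G" using subA by (rule subgroup.subset)
  have xG: "x \<in> carrier G" using x by (simp add: small_element_def)
  have yG: "y \<in> carrier G" using comm[OF a] by (simp add: y_def centralizer_def)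
  have subC: "subgroup C G" and subY: "subgroup Y G"
    unfolding C_def Y_def using centralizer_subgroup xG yG by auto
  have subD: "subgroup D G" and subB: "subgroup B G"
    unfolding D_def B_def using subA subC subY by (auto intro: subgroups_Inter_pair)
  have finsub: "finite H" if "subgroup H G" for H
    using fin that by (meson finite_subset subgroup.subset)
  have pos: "card H > 0" if "subgroup H G" for H
    using finsub[OF that] subgroup.one_closed[OF that] card_gt_0_iff by blast
  have AY: "A \<subseteq> Y"
    using comm[OF a] AG by (auto simp: Y_def y_def centralizer_def)
  have cosets: "r g = r h \<longleftrightarrow> g \<otimes> inv h \<in> A" if "g \<in> carrier G" "h \<in> carrier G" for g h
  proof -
    have "r g = r h \<longleftrightarrow> g \<in> A #> h"
      unfolding r_def using that subA rcos_self repr_independence by blast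
    also have "\<dots> \<longleftrightarrow> g \<otimes> inv h \<in> A"
      using subgroup.rcos_module[OF subA is_group] that by blast
    finally show ?thesis .
  qed
  have cardA: "card A = card S * card B"
    unfolding S_def
  proof (rule card_eq_card_image_mult_card_subgroup[OF subA finsub[OF subA] subB])
    fix g h assume gh: "g \<in> A" "h \<in> A"
    then have "g \<otimes> inv h \<in> A" using subA by (simp add: subgroup.m_closed subgroup.m_inv_closed)
    then show "commutator G g x = commutator G h x \<longleftrightarrow> g \<otimes> inv h \<in> B"
      using commutator_eq_iff_centralizer[OF xG] gh AG by (auto simp: B_def C_def)
  qed (simp add: B_def)
  have cardC: "card C = card T * card D"
    unfolding T_def
  proof (rule card_eq_card_image_mult_card_subgroup[OF subC finsub[OF subC] subD])
    fix g h assume gh: "g \<in> C" "h \<in> C"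
    then have "g \<otimes> inv h \<in> C" using subC by (simp add: subgroup.m_closed subgroup.m_inv_closed)
    then show "inv g \<otimes> y \<otimes> g = inv h \<otimes> y \<otimes> h \<longleftrightarrow> g \<otimes> inv h \<in> D"
      using conj_eq_iff_centralizer[OF yG] gh subgroup.mem_carrier[OF subC]
      by (auto simp: D_def Y_def)
  qed (simp add: D_def)
  have cardY: "card Y = card (r ` Y) * card A"
    by (rule card_eq_card_image_mult_card_subgroup[OF subY finsub[OF subY] subA AY])
      (use cosets subgroup.mem_carrier[OF subY] in blast)
  have cardD: "card D = card (r ` D) * card B"
  proof (rule card_eq_card_image_mult_card_subgroup[OF subD finsub[OF subD] subB])
    fix g h assume gh: "g \<in> D" "h \<in> D"
    then have "g \<otimes> inv h \<in> D" using subD by (simp add: subgroup.m_closed subgroup.m_inv_closed)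
    then show "r g = r h \<longleftrightarrow> g \<otimes> inv h \<in> B"
      using cosets gh subgroup.mem_carrier[OF subD] by (auto simp: B_def D_def)
  qed (use AY in \<open>auto simp: B_def D_def\<close>)
  have "T \<subseteq> S - {\<one>}"
  proof
    fix t assume "t \<in> T"
    then obtain c where c: "c \<in> C" "t = inv c \<otimes> y \<otimes> c" by (auto simp: T_def)
    have cG: "c \<in> carrier G" using c(1) subgroup.mem_carrier[OF subC] by blast
    have "inv c \<otimes> a \<otimes> c \<in> A" using normal.inv_op_closed1[OF A cG a] .
    moreover have "t = commutator G (inv c \<otimes> a \<otimes> c) x"
      using conj_commutator[of c x a] c a AG xG by (auto simp: C_def y_def)
    moreover have "t \<noteq> \<one>"
    proof
      assume "t = \<one>"
      then have "c \<otimes> (inv c \<otimes> y \<otimes> c) \<otimes> inv c = \<one>" using c(2) cG by simp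
      moreover have "c \<otimes> (inv c \<otimes> y \<otimes> c) \<otimes> inv c = y"
        using cG yG by (simp add: m_assoc) (simp flip: m_assoc)
      ultimately show False using False by (simp add: y_def)
    qed
    ultimately show "t \<in> S - {\<one>}" by (auto simp: S_def)
  qed
  moreover have "commutator G \<one> x = \<one>" using xG by (simp add: commutator_def)
  then have "\<one> \<in> S"
    unfolding S_def using subgroup.one_closed[OF subA] by (metis imageI)
  moreover have "finite S" unfolding S_def using finsub[OF subA] by simp
  ultimately have ST: "card T < card S" by (intro psubset_card_mono) auto
  have "card C = card T * (card (r ` D) * card B)" using cardC cardD by simp
  also have "\<dots> < card S * (card (r ` D) * card B)"
    using ST pos[OF subD] cardD by (intro mult_less_mono1) auto
  also have "\<dots> = card (r ` D) * card A" using cardA by (simp add: ac_simps)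
  also have "\<dots> \<le> card (r ` Y) * card A"
    using finsub[OF subY] by (intro mult_le_mono1 card_mono) (auto simp: D_def)
  finally have "card C < card Y" using cardY by simp
  then show ?thesis
    using small_element_centralizer[OF fin x yG] by (simp add: C_def Y_def y_def)
qed

section \<open>Centralizing modulo the center\<close>

lemma group_center_subgroup: "subgroup (group_center G) G"
  unfolding group_center_def by (rule centralizer_subgroup) simp

lemma group_center_commutes:
  assumes "z \<in> group_center G" "g \<in> carrier G"
  shows "z \<otimes> g = g \<otimes> z"
  using assms by (simp add: group_center_def centralizer_def)

lemma commutator_closed [simp]:
  assumes "x \<in> carrier G" "h \<in> carrier G"
  shows "commutator G x h \<in> carrier G"
  using assms by (simp add: commutator_def)

lemma mult_eq_mult_commutator:
  assumes "x \<in> carrier G" "h \<in> carrier G"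
  shows "x \<otimes> h = h \<otimes> x \<otimes> commutator G x h"
proof -
  have "commutator G x h = inv (h \<otimes> x) \<otimes> (x \<otimes> h)"
    using assms by (simp add: commutator_def inv_mult_group m_assoc)
  then have "h \<otimes> x \<otimes> commutator G x h = h \<otimes> x \<otimes> inv (h \<otimes> x) \<otimes> (x \<otimes> h)"
    using assms by (simp only: m_assoc m_closed inv_closed)
  then show ?thesis using assms by simp
qed

lemma commutator_eqI:
  assumes "x \<in> carrier G" "h \<in> carrier G" "z \<in> carrier G" "x \<otimes> h = h \<otimes> x \<otimes> z"
  shows "commutator G x h = z"
proof -
  have "h \<otimes> x \<otimes> commutator G x h = h \<otimes> x \<otimes> z"
    using assms(4) mult_eq_mult_commutator[OF assms(1,2)] by (rule trans[OF sym, rotated])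
  then show ?thesis using assms(1-3) by simp
qed

text \<open>Central factors collected along the way from \<open>a\<close> past \<open>g\<close> and \<open>h\<close> multiply, in an order that
  does not matter.\<close>

lemma mult_mult_eq_mod_center:
  assumes G: "a \<in> carrier G" "g \<in> carrier G" "h \<in> carrier G" "w \<in> carrier G"
    and z: "z \<in> group_center G"
    and ag: "a \<otimes> g = g \<otimes> a \<otimes> z" and ah: "a \<otimes> h = h \<otimes> a \<otimes> w"
  shows "a \<otimes> (g \<otimes> h) = g \<otimes> h \<otimes> a \<otimes> (w \<otimes> z)"
proof -
  have zG: "z \<in> carrier G" using z by (simp add: group_center_def centralizer_def)
  have "a \<otimes> (g \<otimes> h) = g \<otimes> a \<otimes> z \<otimes> h" using G by (simp add: m_assoc flip: ag)
  also have "\<dots> = g \<otimes> (a \<otimes> h) \<otimes> z"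
    using G zG group_center_commutes[OF z, of h] by (simp add: m_assoc)
  also have "\<dots> = g \<otimes> h \<otimes> a \<otimes> (w \<otimes> z)" using G zG by (simp add: ah m_assoc)
  finally show ?thesis .
qed

lemma subgroup_centralizing_mod_center:
  assumes "A \<subseteq> carrier G"
  shows "subgroup {g \<in> carrier G. \<forall>a\<in>A. commutator G a g \<in> group_center G} G"
    (is "subgroup ?N G")
proof (rule subgroupI)
  let ?Z = "group_center G"
  have ZG: "z \<in> carrier G" if "z \<in> ?Z" for z
    using that by (simp add: group_center_def centralizer_def)
  show "?N \<subseteq> carrier G" by auto
  have "commutator G a \<one> = \<one>" if "a \<in> A" for a
    using assms that by (simp add: commutator_def subset_iff)
  then have "\<one> \<in> ?N" using subgroup.one_closed[OF group_center_subgroup] by simp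
  then show "?N \<noteq> {}" by blast
  show "inv g \<in> ?N" if g: "g \<in> ?N" for g
  proof -
    have "commutator G a (inv g) \<in> ?Z" if a: "a \<in> A" for a
    proof -
      define z where "z = commutator G a g"
      have gG: "g \<in> carrier G" and aG: "a \<in> carrier G" and z: "z \<in> ?Z" "z \<in> carrier G"
        using g a assms ZG by (auto simp: z_def)
      have "a \<otimes> g = g \<otimes> a \<otimes> z" using mult_eq_mult_commutator[OF aG gG] by (simp add: z_def)
      then have "inv g \<otimes> (a \<otimes> g) = a \<otimes> z" using gG aG z by (simp add: inv_solve_left' m_assoc)
      then have "inv g \<otimes> a \<otimes> g = z \<otimes> a"
        using gG aG z group_center_commutes by (simp add: m_assoc)
      then have "inv g \<otimes> a = z \<otimes> a \<otimes> inv g" using gG aG z by (simp add: inv_solve_right)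
      then have "inv z \<otimes> (inv g \<otimes> a) = a \<otimes> inv g"
        using gG aG z by (simp add: inv_solve_left' m_assoc)
      then have "a \<otimes> inv g = inv g \<otimes> a \<otimes> inv z"
        using gG aG group_center_commutes[of "inv z" "inv g \<otimes> a"]
          subgroup.m_inv_closed[OF group_center_subgroup z(1)] by simp
      then have "commutator G a (inv g) = inv z" using gG aG z by (intro commutator_eqI) auto
      then show ?thesis using z subgroup.m_inv_closed[OF group_center_subgroup] by simp
    qed
    then show ?thesis using g by simp
  qed
  show "g \<otimes> h \<in> ?N" if g: "g \<in> ?N" and h: "h \<in> ?N" for g h
  proof -
    have "commutator G a (g \<otimes> h) \<in> ?Z" if a: "a \<in> A" for a
    proof -
      define z w where "z = commutator G a g" and "w = commutator G a h"
      have G: "g \<in> carrier G" "h \<in> carrier G" "a \<in> carrier G" "z \<in> ?Z" "w \<in> ?Z"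
          "z \<in> carrier G" "w \<in> carrier G"
        using g h a assms ZG by (auto simp: z_def w_def)
      have "a \<otimes> g = g \<otimes> a \<otimes> z" "a \<otimes> h = h \<otimes> a \<otimes> w"
        using mult_eq_mult_commutator[OF G(3,1)] mult_eq_mult_commutator[OF G(3,2)]
        unfolding z_def w_def by blast+
      then have "a \<otimes> (g \<otimes> h) = g \<otimes> h \<otimes> a \<otimes> (w \<otimes> z)"
        using G by (intro mult_mult_eq_mod_center)
      then have "commutator G a (g \<otimes> h) = w \<otimes> z" using G by (intro commutator_eqI) auto
      then show ?thesis using G subgroup.m_closed[OF group_center_subgroup] by simp
    qed
    then show ?thesis using g h by simp
  qed
qed

text \<open>Both \<open>mn\<close> and \<open>nm\<close> carry \<open>a\<close> past themselves with the same central factor, so their quotient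
  \<open>[m,n]\<close> commutes with \<open>a\<close>. This takes the place of the three subgroups lemma.\<close>

lemma commutator_centralizes:
  assumes "m \<in> carrier G" "n \<in> carrier G" "a \<in> carrier G"
    and "commutator G a m \<in> group_center G" "commutator G a n \<in> group_center G"
  shows "commutator G m n \<otimes> a = a \<otimes> commutator G m n"
proof -
  define z w c where "z = commutator G a m" and "w = commutator G a n" and "c = commutator G m n"
  have G: "z \<in> carrier G" "w \<in> carrier G" "c \<in> carrier G"
    using assms by (simp_all add: z_def w_def c_def)
  have zw: "\<And>g. g \<in> carrier G \<Longrightarrow> z \<otimes> g = g \<otimes> z" "\<And>g. g \<in> carrier G \<Longrightarrow> w \<otimes> g = g \<otimes> w"
    using assms group_center_commutes by (auto simp: z_def w_def)
  have am: "a \<otimes> m = m \<otimes> a \<otimes> z" and an: "a \<otimes> n = n \<otimes> a \<otimes> w" and mn: "m \<otimes> n = n \<otimes> m \<otimes> c"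
    unfolding z_def w_def c_def using mult_eq_mult_commutator assms(1-3) by blast+
  have "a \<otimes> (m \<otimes> n) = m \<otimes> n \<otimes> a \<otimes> (w \<otimes> z)"
    by (rule mult_mult_eq_mod_center) (use am an assms G in \<open>simp_all add: z_def\<close>)
  then have amn: "a \<otimes> (m \<otimes> n) = m \<otimes> n \<otimes> a \<otimes> (z \<otimes> w)" using zw(1)[OF G(2)] by simp
  have anm: "a \<otimes> (n \<otimes> m) = n \<otimes> m \<otimes> a \<otimes> (z \<otimes> w)"
    by (rule mult_mult_eq_mod_center) (use am an assms G in \<open>simp_all add: w_def\<close>)
  have "n \<otimes> m \<otimes> (a \<otimes> c) \<otimes> (z \<otimes> w) = n \<otimes> m \<otimes> a \<otimes> (c \<otimes> (z \<otimes> w))"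
    using assms G by (simp add: m_assoc)
  also have "c \<otimes> (z \<otimes> w) = z \<otimes> w \<otimes> c"
  proof -
    have "c \<otimes> (z \<otimes> w) = z \<otimes> c \<otimes> w" using zw(1)[OF G(3)] G by (simp add: m_assoc)
    also have "\<dots> = z \<otimes> w \<otimes> c" using zw(2)[OF G(3)] G by (simp add: m_assoc)
    finally show ?thesis .
  qed
  also have "n \<otimes> m \<otimes> a \<otimes> (z \<otimes> w \<otimes> c) = n \<otimes> m \<otimes> a \<otimes> (z \<otimes> w) \<otimes> c"
    using assms G by (simp add: m_assoc)
  also have "\<dots> = a \<otimes> (n \<otimes> m) \<otimes> c" by (simp add: anm)
  also have "\<dots> = a \<otimes> (m \<otimes> n)" using assms G by (simp add: mn m_assoc)
  also have "\<dots> = n \<otimes> m \<otimes> c \<otimes> a \<otimes> (z \<otimes> w)" by (simp only: amn) (simp only: mn)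
  also have "\<dots> = n \<otimes> m \<otimes> (c \<otimes> a) \<otimes> (z \<otimes> w)" using assms G by (simp add: m_assoc)
  finally show ?thesis using assms G by (simp add: c_def)
qed

section \<open>The lower central series of a subgroup\<close>

lemma lower_central_subset_carrier: "lower_central G n \<subseteq> carrier G"
proof (induction n)
  case (Suc n)
  then have "{commutator G x h | x h. x \<in> lower_central G n \<and> h \<in> carrier G} \<subseteq> carrier G"
    by auto
  then show ?case by (simp add: generate_incl)
qed simp

lemma one_in_lower_central: "\<one> \<in> lower_central G n"
  by (cases n) (auto intro: generate.one)

text \<open>The bound \<open>N\<close> is allowed to stick out of \<open>H\<close>: the series is going to be compared with
  \<open>C\<^sub>G(A)\<close> and with the center of \<open>G\<close>, and \<open>N \<inter> H\<close> absorbs the difference.\<close>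

lemma lower_central_Suc_subset:
  assumes H: "subgroup H G" and N: "subgroup N G"
    and comm: "\<And>u h. u \<in> lower_central (G\<lparr>carrier := H\<rparr>) n \<Longrightarrow> h \<in> H \<Longrightarrow> commutator G u h \<in> N"
  shows "lower_central (G\<lparr>carrier := H\<rparr>) (Suc n) \<subseteq> N"
proof -
  let ?H = "G\<lparr>carrier := H\<rparr>"
  interpret H: group ?H using subgroup_imp_group[OF H] .
  have eq: "commutator ?H u h = commutator G u h" if "u \<in> H" "h \<in> H" for u h
    using that H by (simp add: commutator_def)
  have uH: "u \<in> H" if "u \<in> lower_central ?H n" for u
    using H.lower_central_subset_carrier that by auto
  have "{commutator ?H u h | u h. u \<in> lower_central ?H n \<and> h \<in> carrier ?H} \<subseteq> N \<inter> H"
    using eq uH comm H.commutator_closed by force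
  moreover have "subgroup (N \<inter> H) ?H"
    using subgroup_incl[OF subgroups_Inter_pair[OF N H] H] by simp
  ultimately have "lower_central ?H (Suc n) \<subseteq> N \<inter> H"
    unfolding lower_central.simps by (rule H.generate_subgroup_incl)
  then show ?thesis by blast
qed

end

theorem corollaryD:
  fixes G :: "('a, 'b) monoid_scheme" and A :: "'a set"
  assumes "group G"
    and "finite (carrier G)"
    and "A \<lhd> G"
    and "centralizer G A \<subseteq> A"
    and "\<And>x. small_element G x \<Longrightarrow>
           {commutator G a x | a. a \<in> A} \<subseteq> group_center (G\<lparr>carrier := A\<rparr>)"
  shows "nilpotent_group (G\<lparr>carrier := small_subgroup G\<rparr>) \<and>
         nilpotency_class (G\<lparr>carrier := small_subgroup G\<rparr>) \<le> 3"
proof -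
  interpret group G by fact
  let ?M = "small_subgroup G"
  let ?MG = "G\<lparr>carrier := ?M\<rparr>"
  have AG: "A \<subseteq> carrier G" using assms(3) normal_imp_subgroup subgroup.subset by blast
  have subM: "subgroup ?M G"
    unfolding small_subgroup_def by (rule generate_is_subgroup) (auto simp: small_element_def)
  have "commutator G a x \<in> group_center G" if x: "small_element G x" and a: "a \<in> A" for a x
  proof (rule small_commutator_central[OF assms(2,3) x _ a])
    fix b assume "b \<in> A"
    then show "commutator G b x \<in> centralizer G A"
      using assms(5)[OF x] AG by (auto simp: group_center_def centralizer_def)
  qed
  then have "?M \<subseteq> {g \<in> carrier G. \<forall>a\<in>A. commutator G a g \<in> group_center G}"
    unfolding small_subgroup_def
    by (intro generate_subgroup_incl subgroup_centralizing_mod_center AG)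
      (auto simp: small_element_def)
  then have M: "m \<in> carrier G" "a \<in> A \<Longrightarrow> commutator G a m \<in> group_center G" if "m \<in> ?M" for a m
    using that by auto
  have "lower_central ?MG (Suc 0) \<subseteq> centralizer G A"
  proof (rule lower_central_Suc_subset[OF subM centralizer_subgroup[OF AG]])
    fix m n assume "m \<in> lower_central ?MG 0" "n \<in> ?M"
    then show "commutator G m n \<in> centralizer G A"
      using M AG commutator_centralizes by (auto simp: centralizer_def)
  qed
  then have "lower_central ?MG (Suc 0) \<subseteq> A" using assms(4) by blast
  then have sub: "lower_central ?MG (Suc (Suc 0)) \<subseteq> group_center G"
    using M by (intro lower_central_Suc_subset subM group_center_subgroup) blast
  have "commutator G z m = \<one>\<^bsub>G\<^esub>" if "z \<in> lower_central ?MG (Suc (Suc 0))" "m \<in> ?M" for z m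
  proof -
    have z: "z \<in> group_center G" and mG: "m \<in> carrier G" using sub that M(1) by blast+
    have zG: "z \<in> carrier G" using z by (simp add: group_center_def centralizer_def)
    show ?thesis
      using group_center_commutes[OF z mG] zG mG by (intro commutator_eqI) simp_all
  qed
  then have "lower_central ?MG (Suc (Suc (Suc 0))) \<subseteq> {\<one>\<^bsub>G\<^esub>}"
    by (intro lower_central_Suc_subset subM triv_subgroup) blast
  then have "lower_central ?MG 3 \<subseteq> {\<one>\<^bsub>?MG\<^esub>}"
    by (simp add: numeral_3_eq_3 del: lower_central.simps)
  moreover have "\<one>\<^bsub>?MG\<^esub> \<in> lower_central ?MG 3"
    by (rule group.one_in_lower_central[OF subgroup_imp_group[OF subM]])
  ultimately have "lower_central ?MG 3 = {\<one>\<^bsub>?MG\<^esub>}" by blast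
  then have "nilpotent_group ?MG" "nilpotency_class ?MG \<le> 3"
    unfolding nilpotent_group_def nilpotency_class_def
    using subgroup_imp_group[OF subM] by (blast, intro Least_le)
  then show ?thesis ..
qed

end
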